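(* Let $R$ be a commutative ring with identity and $S\subseteq R$ a multiplicative set. Suppose that $R$ is $u$-$S$-reduced with respect to some $s\in S$. Then $R$ is $u$-$S$-Armendariz.
   Context: A multiplicative set $S\subseteq R$ is a subset containing $1$ and closed under multiplication. $R$ is $u$-$S$-reduced (with respect to $s$) if there is a fixed element $s\in S$, depending only on $R$, such that $sa=0$ for every $a\in R$ with $a^n=0$ for some $n\in\mathbb{N}$. $R$ is $u$-$S$-Armendariz if for any polynomials $f=\sum_{i=0}^m a_iX^i$ and $g=\sum_{j=0}^n b_jX^j$ in $R[X]$ with $fg=0$, there exists $s\in S$ such that $sa_ib_j=0$ for all indices $i$ and $j$. *)

theory Defs
  imports "HOL-Algebra.Algebra"
begin

text \<open>
  Rings are in the sense of the locale \<^locale>\<open>cring\<close>, so the zero ring is allowed. A multiplicative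
  set is a \<^const>\<open>submonoid\<close> of the multiplicative monoid of the ring.
\<close>

definition u_S_reduced_wrt :: "('a, 'm) ring_scheme \<Rightarrow> 'a set \<Rightarrow> 'a \<Rightarrow> bool" where
  "u_S_reduced_wrt R S s \<longleftrightarrow>
     s \<in> S \<and>
     (\<forall>a \<in> carrier R. (\<exists>n::nat. a [^]\<^bsub>R\<^esub> n = \<zero>\<^bsub>R\<^esub>) \<longrightarrow> s \<otimes>\<^bsub>R\<^esub> a = \<zero>\<^bsub>R\<^esub>)"

text \<open>
  Below, \<open>s\<close> may depend on \<open>f\<close> and \<open>g\<close> but not on the indices. The indices range over all natural
  numbers, so no degree bounds are needed: the coefficients beyond the degree are zero.
\<close>

definition u_S_Armendariz :: "('a, 'm) ring_scheme \<Rightarrow> 'a set \<Rightarrow> bool" where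
  "u_S_Armendariz R S \<longleftrightarrow>
     (\<forall>f \<in> carrier (UP R). \<forall>g \<in> carrier (UP R).
        f \<otimes>\<^bsub>UP R\<^esub> g = \<zero>\<^bsub>UP R\<^esub> \<longrightarrow>
        (\<exists>s \<in> S. \<forall>i j.
           s \<otimes>\<^bsub>R\<^esub> coeff (UP R) f i \<otimes>\<^bsub>R\<^esub> coeff (UP R) g j = \<zero>\<^bsub>R\<^esub>))"

end

theory Submission imports Defs begin

text \<open>
  In a \<open>u\<close>-\<open>S\<close>-reduced ring the element \<open>t = s\<^sup>2\<close> annihilates every \<open>x\<close> whose square it annihilates:
  \<open>t x\<^sup>2 = 0\<close> says that \<open>s x\<close> is nilpotent. Hence the usual argument for reduced rings works modulo
  the annihilator of \<open>t\<close>. By induction on \<open>k = i + j\<close>, multiply the \<open>k\<close>-th coefficient of \<open>f g = 0\<close>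
  by \<open>t x\<close> with \<open>x = a\<^sub>i b\<^sub>j\<close>. A term \<open>t x a\<^sub>p b\<^sub>q\<close> with \<open>p + q = k\<close> and \<open>p \<noteq> i\<close> contains both
  \<open>a\<^sub>i b\<^sub>q\<close> and \<open>a\<^sub>p b\<^sub>j\<close>, one of which has index sum below \<open>k\<close>, so only \<open>t x\<^sup>2\<close> survives.
\<close>

lemma (in cring) nilpotent_annihilated_square:
  assumes s: "s \<in> carrier R" and x: "x \<in> carrier R"
    and nil: "\<And>a n. a \<in> carrier R \<Longrightarrow> a [^] (n::nat) = \<zero> \<Longrightarrow> s \<otimes> a = \<zero>"
    and sq: "s \<otimes> s \<otimes> (x \<otimes> x) = \<zero>"
  shows "s \<otimes> s \<otimes> x = \<zero>"
proof -
  have "(s \<otimes> x) [^] (2::nat) = \<zero>"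
    using s x sq by (simp add: numeral_2_eq_2 m_ac)
  then have "s \<otimes> (s \<otimes> x) = \<zero>"
    using nil s x by blast
  then show ?thesis
    using s x by (simp add: m_assoc)
qed

text \<open>Here \<open>red\<close> says that the quotient by the annihilator of \<open>t\<close> is
  reduced, and \<open>conv\<close> is \<open>f g = 0\<close> read coefficientwise.\<close>

lemma (in cring) coefficient_products_annihilated:
  fixes a b :: "nat \<Rightarrow> 'a"
  assumes t: "t \<in> carrier R"
    and a: "\<And>i. a i \<in> carrier R" and b: "\<And>j. b j \<in> carrier R"
    and red: "\<And>x. x \<in> carrier R \<Longrightarrow> t \<otimes> (x \<otimes> x) = \<zero> \<Longrightarrow> t \<otimes> x = \<zero>"
    and conv: "\<And>k. (\<Oplus>p \<in> {..k}. a p \<otimes> b (k - p)) = \<zero>"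
  shows "t \<otimes> (a i \<otimes> b j) = \<zero>"
proof (induction "i + j" arbitrary: i j rule: less_induct)
  case less
  define k where "k = i + j"
  define x where "x = a i \<otimes> b j"
  have x: "x \<in> carrier R"
    using a b by (simp add: x_def)
  have cross: "t \<otimes> x \<otimes> (a p \<otimes> b (k - p)) = \<zero>" if "p \<le> k" "p \<noteq> i" for p
  proof (cases "p < i")
    case True
    then have "t \<otimes> (a p \<otimes> b j) = \<zero>"
      by (intro less) simp
    moreover have "t \<otimes> x \<otimes> (a p \<otimes> b (k - p)) = t \<otimes> (a p \<otimes> b j) \<otimes> (a i \<otimes> b (k - p))"
      using t a b by (simp add: x_def m_ac)
    ultimately show ?thesis
      using a b by simp
  next
    case False
    \<comment> \<open>Now \<open>i < p \<le> k\<close>, so \<open>k - p < j\<close> and the index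
      sum drops below \<open>k\<close>.\<close>
    then have "t \<otimes> (a i \<otimes> b (k - p)) = \<zero>"
      using that by (intro less) (simp add: k_def)
    moreover have "t \<otimes> x \<otimes> (a p \<otimes> b (k - p)) = t \<otimes> (a i \<otimes> b (k - p)) \<otimes> (a p \<otimes> b j)"
      using t a b by (simp add: x_def m_ac)
    ultimately show ?thesis
      using a b by simp
  qed
  have "\<zero> = t \<otimes> x \<otimes> (\<Oplus>p \<in> {..k}. a p \<otimes> b (k - p))"
    using t x by (simp add: conv)
  also have "\<dots> = (\<Oplus>p \<in> {..k}. t \<otimes> x \<otimes> (a p \<otimes> b (k - p)))"
    using t x a b by (intro finsum_rdistr) auto
  \<comment> \<open>At \<open>p = i\<close> the index \<open>k - p\<close> is \<open>j\<close>, so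
    that term is \<open>t \<otimes> x \<otimes> x\<close>.\<close>
  also have "\<dots> = (\<Oplus>p \<in> {..k}. if i = p then t \<otimes> x \<otimes> x else \<zero>)"
    using t x a b cross by (intro finsum_cong') (auto simp: k_def x_def)
  also have "\<dots> = t \<otimes> x \<otimes> x"
    using t x by (intro finsum_singleton) (auto simp: k_def)
  finally have "t \<otimes> (x \<otimes> x) = \<zero>"
    using t x by (simp add: m_assoc)
  then show ?case
    using red[OF x] by (simp only: x_def)
qed

theorem theorem3p5:
  fixes R :: "('a, 'm) ring_scheme" and S :: "'a set" and s :: 'a
  assumes "cring R"
    and "submonoid S R"
    and "u_S_reduced_wrt R S s"
  shows "u_S_Armendariz R S"
  unfolding u_S_Armendariz_def
proof (intro ballI impI)
  interpret U: UP_cring R "UP R"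
    using assms(1) by (simp add: UP_cring_def)
  interpret S: submonoid S R
    by (rule assms(2))
  have sS: "s \<in> S"
    and nil: "\<And>a n. a \<in> carrier R \<Longrightarrow> a [^]\<^bsub>R\<^esub> (n::nat) = \<zero>\<^bsub>R\<^esub> \<Longrightarrow> s \<otimes>\<^bsub>R\<^esub> a = \<zero>\<^bsub>R\<^esub>"
    using assms(3) unfolding u_S_reduced_wrt_def by blast+
  have s: "s \<in> carrier R"
    using sS S.subset by blast
  fix f g
  assume f: "f \<in> carrier (UP R)" and g: "g \<in> carrier (UP R)"
    and fg: "f \<otimes>\<^bsub>UP R\<^esub> g = \<zero>\<^bsub>UP R\<^esub>"
  have conv: "(\<Oplus>\<^bsub>R\<^esub>p \<in> {..k}. coeff (UP R) f p \<otimes>\<^bsub>R\<^esub> coeff (UP R) g (k - p)) = \<zero>\<^bsub>R\<^esub>" for k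
    using U.coeff_mult[OF f g, of k] by (simp add: fg)
  have "s \<otimes>\<^bsub>R\<^esub> s \<otimes>\<^bsub>R\<^esub> (coeff (UP R) f i \<otimes>\<^bsub>R\<^esub> coeff (UP R) g j) = \<zero>\<^bsub>R\<^esub>" for i j
    using s f g conv U.R.nilpotent_annihilated_square[OF s _ nil]
    by (intro U.R.coefficient_products_annihilated) (assumption | simp)+
  \<comment> \<open>The witness \<open>s \<otimes> s\<close> lies in \<open>S\<close> by closure and
    is the same for all \<open>f\<close> and \<open>g\<close>.\<close>
  then show "\<exists>s \<in> S. \<forall>i j. s \<otimes>\<^bsub>R\<^esub> coeff (UP R) f i \<otimes>\<^bsub>R\<^esub> coeff (UP R) g j = \<zero>\<^bsub>R\<^esub>"
    using s sS f g by (intro bexI[of _ "s \<otimes>\<^bsub>R\<^esub> s"]) (simp_all add: U.R.m_assoc)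
qed

end
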